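(* Let $P$ be a homogeneous degree-two tropical polynomial in $X,Y,Z$, and let $\mathcal{C}=\mathcal{C}(P)$ be its tropical conic. The matrix $\operatorname{shape}(P)^+$ is tropically singular if and only if $\mathcal{C}$ is either a pair of tropical lines or a one-point central conic.
   Context: $\mathbb{T}=\mathbb{R}\cup\{-\infty\}$. $\mathbb{T}\mathbb{P}^2$ is the set of classes $[b_1,b_2,b_3]$ of triples in $\mathbb{T}^3\setminus\{(-\infty,-\infty,-\infty)\}$ under adding a real multiple of $(1,1,1)$. A homogeneous degree-two tropical polynomial is $P=\max\{a_{11}+2X,a_{22}+2Y,a_{33}+2Z,a_{21}+X+Y,a_{32}+Y+Z,a_{31}+X+Z\}$ with $a_{11},a_{22},a_{33}\in\mathbb{R}$ and $a_{21},a_{32},a_{31}\in\mathbb{T}$. The tropical conic $\mathcal{C}(P)$ is the set of points of $\mathbb{T}\mathbb{P}^2$ where the maximum is attained by at least two of the six terms. The shape matrix $\operatorname{shape}(P)=(s_{ij})$ is the symmetric $3\times3$ matrix with $s_{ii}=0$ and $s_{ij}=a_{ij}-\tfrac12(a_{ii}+a_{jj})$ for $i\ne j$. $\operatorname{shape}(P)^+=(s_{ij}^+)$ is obtained by replacing each entry $a$ by $a^+=\max\{a,0\}$. Put $d_1=s_{21}^+-s_{32}^++s_{31}^+$, $d_2=s_{21}^++s_{32}^+-s_{31}^+$, $d_3=-s_{21}^++s_{32}^++s_{31}^+$. The conic $\mathcal{C}(P)$ is called one-point central if $s_{ij}^+>0$ for all $i\ne j$ and $d_1,d_2,d_3$ are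 all positive. A tropical line is the set of points of $\mathbb{T}\mathbb{P}^2$ at which $\max\{\alpha+X,\beta+Y,\gamma+Z\}$ is attained at least twice, for some $\alpha,\beta,\gamma\in\mathbb{R}$. A pair of tropical lines is a union of two tropical lines (which may coincide). A $3\times 3$ matrix $(m_{ij})$ is tropically singular if the maximum $\max_{\sigma\in S_3}\{m_{1\sigma(1)}+m_{2\sigma(2)}+m_{3\sigma(3)}\}$ is attained by at least two permutations $\sigma$. *)

theory Defs
  imports "HOL-Analysis.Analysis"
begin

text \<open>
  The tropical numbers \<open>\<real> \<union> {-\<infinity>}\<close> are the extended reals other than \<open>\<infinity>\<close>. On these,
  addition, and multiplication by a positive real, of type \<^typ>\<open>ereal\<close> have their tropical meaning.
  In the index type \<^typ>\<open>3\<close> the numeral \<open>3\<close> equals \<open>0\<close>, so its order is never used.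
\<close>

definition attained_twice :: "('i \<Rightarrow> 'a::linorder) \<Rightarrow> 'i set \<Rightarrow> bool" where
  "attained_twice f I \<longleftrightarrow>
     (\<exists>i\<in>I. \<exists>j\<in>I. i \<noteq> j \<and> f i = Max (f ` I) \<and> f j = Max (f ` I))"

definition trop_triples :: "(ereal^3) set" where
  "trop_triples = {b. (\<forall>i. b $ i \<noteq> \<infinity>) \<and> (\<exists>i. b $ i \<noteq> -\<infinity>)}"

definition proj_rel :: "((ereal^3) \<times> (ereal^3)) set" where
  "proj_rel = {(b, c). b \<in> trop_triples \<and> c \<in> trop_triples \<and>
                       (\<exists>t::real. \<forall>i. c $ i = ereal t + b $ i)}"

definition TP2 :: "(ereal^3) set set" where
  "TP2 = trop_triples // proj_rel"

definition trop_line :: "real^3 \<Rightarrow> (ereal^3) set set" where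
  "trop_line c = {p \<in> TP2. \<exists>b\<in>p. attained_twice (\<lambda>i. ereal (c $ i) + b $ i) UNIV}"

definition pair_of_lines :: "(ereal^3) set set \<Rightarrow> bool" where
  "pair_of_lines C \<longleftrightarrow> (\<exists>c c'. C = trop_line c \<union> trop_line c')"

record quadric =
  a11 :: real
  a22 :: real
  a33 :: real
  a21 :: ereal
  a32 :: ereal
  a31 :: ereal

definition is_trop_quadric :: "quadric \<Rightarrow> bool" where
  "is_trop_quadric P \<longleftrightarrow> a21 P \<noteq> \<infinity> \<and> a32 P \<noteq> \<infinity> \<and> a31 P \<noteq> \<infinity>"

definition quadric_terms :: "quadric \<Rightarrow> ereal^3 \<Rightarrow> ereal list" where
  "quadric_terms P b =
     [ereal (a11 P) + 2 * b $ 1, ereal (a22 P) + 2 * b $ 2, ereal (a33 P) + 2 * b $ 3,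
      a21 P + b $ 1 + b $ 2, a32 P + b $ 2 + b $ 3, a31 P + b $ 1 + b $ 3]"

definition trop_conic :: "quadric \<Rightarrow> (ereal^3) set set" where
  "trop_conic P = {p \<in> TP2. \<exists>b\<in>p. attained_twice (\<lambda>k. quadric_terms P b ! k) {..<6}}"

definition coeff_matrix :: "quadric \<Rightarrow> ereal^3^3" where
  "coeff_matrix P = vector
     [vector [ereal (a11 P), a21 P, a31 P],
      vector [a21 P, ereal (a22 P), a32 P],
      vector [a31 P, a32 P, ereal (a33 P)]]"

definition shape :: "quadric \<Rightarrow> ereal^3^3" where
  "shape P = (\<chi> i j. if i = j then 0 else
     coeff_matrix P $ i $ j - (coeff_matrix P $ i $ i + coeff_matrix P $ j $ j) / 2)"

definition matrix_plus :: "ereal^3^3 \<Rightarrow> ereal^3^3" where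
  "matrix_plus M = (\<chi> i j. max (M $ i $ j) 0)"

definition one_point_central :: "quadric \<Rightarrow> bool" where
  "one_point_central P \<longleftrightarrow>
     (let s = matrix_plus (shape P);
          d1 = s $ 2 $ 1 - s $ 3 $ 2 + s $ 3 $ 1;
          d2 = s $ 2 $ 1 + s $ 3 $ 2 - s $ 3 $ 1;
          d3 = - s $ 2 $ 1 + s $ 3 $ 2 + s $ 3 $ 1
      in (\<forall>i j. i \<noteq> j \<longrightarrow> s $ i $ j > 0) \<and> d1 > 0 \<and> d2 > 0 \<and> d3 > 0)"

definition trop_singular :: "ereal^3^3 \<Rightarrow> bool" where
  "trop_singular M \<longleftrightarrow>
     attained_twice (\<lambda>\<sigma>. \<Sum>i\<in>UNIV. M $ i $ \<sigma> i) {\<sigma>. \<sigma> permutes UNIV}"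

lemma equiv_proj_rel: "equiv trop_triples proj_rel"
proof (rule equivI)
  show "refl_on trop_triples proj_rel"
    by (auto simp: refl_on_def proj_rel_def intro!: exI[of _ 0])
  show "sym proj_rel"
  proof (rule symI)
    fix b c assume "(b, c) \<in> proj_rel"
    then obtain t where t: "b \<in> trop_triples" "c \<in> trop_triples" "\<And>i. c $ i = ereal t + b $ i"
      by (auto simp: proj_rel_def)
    have "b $ i = ereal (-t) + c $ i" for i
      by (cases "b $ i") (auto simp: t(3))
    then show "(c, b) \<in> proj_rel" using t by (auto simp: proj_rel_def)
  qed
  show "trans proj_rel"
  proof (rule transI)
    fix b c d assume "(b, c) \<in> proj_rel" "(c, d) \<in> proj_rel"
    then obtain t u where t: "b \<in> trop_triples" "d \<in> trop_triples"
        "\<And>i. c $ i = ereal t + b $ i" "\<And>i. d $ i = ereal u + c $ i"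
      by (auto simp: proj_rel_def)
    have "d $ i = ereal (u + t) + b $ i" for i
      by (cases "b $ i") (auto simp: t(3,4))
    then show "(b, d) \<in> proj_rel" using t by (auto simp: proj_rel_def)
  qed
  show "proj_rel \<subseteq> trop_triples \<times> trop_triples" by (auto simp: proj_rel_def)
qed

text \<open>The choice of representative in \<open>trop_line\<close> and \<open>trop_conic\<close> is immaterial.\<close>

lemma attained_twice_shift:
  fixes f g :: "'i \<Rightarrow> ereal"
  assumes "finite I" and g: "\<And>i. i \<in> I \<Longrightarrow> g i = ereal t + f i"
  shows "attained_twice g I \<longleftrightarrow> attained_twice f I"
proof (cases "I = {}")
  case True
  then show ?thesis by (simp add: attained_twice_def)
next
  case False
  have "mono (\<lambda>x. ereal t + x)"
    by (intro monoI add_left_mono)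
  from mono_Max_commute[OF this, of "f ` I"] assms(1) False
  have "Max (g ` I) = ereal t + Max (f ` I)"
    by (simp add: image_image g cong: image_cong)
  then show ?thesis
    by (simp add: attained_twice_def g ereal_add_cancel_left cong: bex_cong)
qed

lemma trop_line_rep_independent:
  assumes "(b, c) \<in> proj_rel"
  shows "attained_twice (\<lambda>i. ereal (l $ i) + c $ i) UNIV \<longleftrightarrow>
         attained_twice (\<lambda>i. ereal (l $ i) + b $ i) UNIV"
proof -
  obtain t where "\<And>i. c $ i = ereal t + b $ i"
    using assms by (auto simp: proj_rel_def)
  then show ?thesis
    by (intro attained_twice_shift[where t = t]) (auto simp: ac_simps)
qed

lemma trop_conic_rep_independent:
  assumes "(b, c) \<in> proj_rel"
  shows "attained_twice (\<lambda>k. quadric_terms P c ! k) {..<6} \<longleftrightarrow>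
         attained_twice (\<lambda>k. quadric_terms P b ! k) {..<6}"
proof -
  obtain t where t: "\<And>i. c $ i = ereal t + b $ i"
    using assms by (auto simp: proj_rel_def)
  have sq: "ereal a + 2 * (ereal t + x) = ereal (2 * t) + (ereal a + 2 * x)" for a x
    by (cases x) auto
  have mix: "a + (ereal t + x) + (ereal t + y) = ereal (2 * t) + (a + x + y)" for a x y
    by (cases a; cases x; cases y) auto
  have "quadric_terms P c = map (\<lambda>x. ereal (2 * t) + x) (quadric_terms P b)"
    by (simp only: quadric_terms_def t sq mix list.map)
  moreover have "length (quadric_terms P b) = 6"
    by (simp add: quadric_terms_def)
  ultimately show ?thesis
    by (intro attained_twice_shift[where t = "2 * t"]) auto
qed

end

theory Submission
  imports Defs
begin

text \<open>
  Write \<open>w\<close> for the matrix \<open>shape(P)\<^sup>+\<close>. It is symmetric and nonnegative with zero diagonal, and it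
  is tropically singular iff its two 3-cycles attain the maximum, i.e. iff \<open>w\<close> satisfies the triangle
  inequality. If the inequality is strict, the conic is one-point central. If
  \<open>w i k = w i j + w j k\<close>, then \<open>w\<close> embeds isometrically into the real line,
  \<open>w i j = \<bar>\<alpha> i - \<alpha> j\<bar>\<close>, and \<open>P\<close> agrees as a function with the tropical product of the linear
  forms with coefficients \<open>\<alpha>\<close> and \<open>-\<alpha>\<close> (in normalised coordinates). If finally
  \<open>w j k > w i j + w i k\<close>, then the conic contains a segment along which \<open>2X\<^sub>i = w j k + X\<^sub>j + X\<^sub>k\<close>;
  every tropical line meets the line spanned by that segment in finitely many points.
\<close>

section \<open>Attained maxima\<close>

lemma attained_twice_iff:
  assumes "finite I"
  shows "attained_twice f I \<longleftrightarrow>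
    (\<exists>i\<in>I. \<exists>j\<in>I. i \<noteq> j \<and> f i = f j \<and> (\<forall>k\<in>I. f k \<le> f i))"
proof -
  have "f i = Max (f ` I) \<and> f j = Max (f ` I) \<longleftrightarrow> f i = f j \<and> (\<forall>k\<in>I. f k \<le> f i)"
    if "i \<in> I" for i j
  proof -
    have "f i = Max (f ` I) \<longleftrightarrow> (\<forall>k\<in>I. f k \<le> f i)"
      using assms that by (subst eq_Max_iff) auto
    then show ?thesis
      by auto
  qed
  then show ?thesis
    unfolding attained_twice_def by (simp cong: bex_cong)
qed

section \<open>Permutations of three indices and tropical singularity\<close>

lemma exhaust_3_distinct:
  fixes i j k m :: 3
  assumes "i \<noteq> j" "i \<noteq> k" "j \<noteq> k"
  shows "m = i \<or> m = j \<or> m = k"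
proof -
  have "{i, j, k} = UNIV"
    using assms by (intro card_subset_eq) auto
  then show ?thesis
    by auto
qed

lemma permutes_3_cases:
  fixes \<sigma> :: "3 \<Rightarrow> 3"
  assumes "\<sigma> permutes UNIV"
  shows "(\<sigma> 1, \<sigma> 2, \<sigma> 3) \<in> {(1,2,3), (1,3,2), (2,1,3), (2,3,1), (3,1,2), (3,2,1)}"
proof -
  have "inj \<sigma>"
    using assms by (rule permutes_inj)
  then have "\<sigma> 1 \<noteq> \<sigma> 2" "\<sigma> 1 \<noteq> \<sigma> 3" "\<sigma> 2 \<noteq> \<sigma> 3"
    by (auto simp: inj_eq)
  then show ?thesis
    using exhaust_3[of "\<sigma> 1"] exhaust_3[of "\<sigma> 2"] exhaust_3[of "\<sigma> 3"]
    by (elim disjE) simp_all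
qed

text \<open>The identity has weight 0, the transposition of \<open>i\<close> and \<open>j\<close>
  has weight \<open>2 * w i j\<close>, and both 3-cycles have the perimeter
  \<open>w 1 2 + w 1 3 + w 2 3\<close> as weight. The perimeter is maximal exactly under the
  triangle inequality. A tie at the maximum without a 3-cycle also implies the inequality: either
  all entries vanish or the two largest are equal.\<close>

lemma trop_singular_iff_triangle:
  fixes M :: "ereal^3^3" and w :: "3 \<Rightarrow> 3 \<Rightarrow> real"
  assumes M: "\<And>i j. M $ i $ j = ereal (w i j)"
    and sym: "\<And>i j. w i j = w j i" and diag: "\<And>i. w i i = 0" and nonneg: "\<And>i j. w i j \<ge> 0"
  shows "trop_singular M \<longleftrightarrow> (\<forall>i j k. w i k \<le> w i j + w j k)"
proof -
  define v where "v \<sigma> = w 1 (\<sigma> 1) + w 2 (\<sigma> 2) + w 3 (\<sigma> 3)" for \<sigma> :: "3 \<Rightarrow> 3"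
  have sing: "trop_singular M \<longleftrightarrow> (\<exists>\<sigma> \<tau>. \<sigma> permutes UNIV \<and> \<tau> permutes UNIV \<and> \<sigma> \<noteq> \<tau> \<and> v \<sigma> = v \<tau> \<and>
      (\<forall>\<rho>. \<rho> permutes UNIV \<longrightarrow> v \<rho> \<le> v \<sigma>))"
    unfolding trop_singular_def
    by (subst attained_twice_iff) (auto simp: finite_permutations M sum_3 v_def)
  have sym': "w 2 1 = w 1 2" "w 3 1 = w 1 3" "w 3 2 = w 2 3"
    by (rule sym)+
  have nonneg': "w 1 2 \<ge> 0" "w 1 3 \<ge> 0" "w 2 3 \<ge> 0"
    by (rule nonneg)+
  have tri: "(\<forall>i j k. w i k \<le> w i j + w j k) \<longleftrightarrow>
      w 1 2 \<le> w 1 3 + w 2 3 \<and> w 1 3 \<le> w 1 2 + w 2 3 \<and> w 2 3 \<le> w 1 2 + w 1 3"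
    using nonneg' by (auto simp: forall_3 sym' diag)
  show ?thesis
  proof
    assume "trop_singular M"
    then obtain \<sigma> \<tau> where perm: "\<sigma> permutes UNIV" "\<tau> permutes UNIV" and "\<sigma> \<noteq> \<tau>"
      and eq: "v \<sigma> = v \<tau>" and max: "\<And>\<rho>. \<rho> permutes UNIV \<Longrightarrow> v \<rho> \<le> v \<sigma>"
      using sing by auto
    from \<open>\<sigma> \<noteq> \<tau>\<close> have ne: "(\<sigma> 1, \<sigma> 2, \<sigma> 3) \<noteq> (\<tau> 1, \<tau> 2, \<tau> 3)"
      by (auto simp: fun_eq_iff forall_3)
    have "v (Transposition.transpose 1 2) \<le> v \<sigma>" "v (Transposition.transpose 1 3) \<le> v \<sigma>"
        "v (Transposition.transpose 2 3) \<le> v \<sigma>"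
      by (auto intro!: max permutes_swap_id)
    then have "2 * w 1 2 \<le> v \<sigma>" "2 * w 1 3 \<le> v \<sigma>" "2 * w 2 3 \<le> v \<sigma>"
      by (simp_all add: v_def Transposition.transpose_def sym' diag)
    then show "\<forall>i j k. w i k \<le> w i j + w j k"
      using permutes_3_cases[OF perm(1)] permutes_3_cases[OF perm(2)] ne eq nonneg'
      unfolding tri v_def by (auto simp: sym' diag)
  next
    assume "\<forall>i j k. w i k \<le> w i j + w j k"
    note tri' = this[unfolded tri]
    \<comment> \<open>Addition on the type \<open>3\<close> is modulo 3, so these shifts are the two
      3-cycles.\<close>
    define \<sigma> \<tau> :: "3 \<Rightarrow> 3" where "\<sigma> i = i + 1" and "\<tau> i = i + 2" for i
    have perm: "\<sigma> permutes UNIV" "\<tau> permutes UNIV"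
      unfolding \<sigma>_def \<tau>_def by (auto intro!: bij_imp_permutes simp: bij_plus_right)
    have [simp]: "\<sigma> 1 = 2" "\<sigma> 2 = 3" "\<sigma> 3 = 1" "\<tau> 1 = 3" "\<tau> 2 = 1" "\<tau> 3 = 2"
      by (simp_all add: \<sigma>_def \<tau>_def)
    have "v \<rho> \<le> v \<sigma>" if "\<rho> permutes UNIV" for \<rho>
      using permutes_3_cases[OF that] tri' nonneg' unfolding v_def by (auto simp: sym' diag)
    moreover have "v \<sigma> = v \<tau>"
      by (simp add: v_def sym')
    moreover have "\<sigma> 1 \<noteq> \<tau> 1"
      by simp
    then have "\<sigma> \<noteq> \<tau>"
      by metis
    ultimately show "trop_singular M"
      unfolding sing using perm by blast
  qed
qed

section \<open>Products of two linear forms\<close>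

text \<open>The pairs \<open>{i, j}\<close> index the monomials of degree two.\<close>

lemma attained_twice_product:
  fixes u :: "'i::finite \<Rightarrow> ereal" and s :: "'i \<Rightarrow> 'i \<Rightarrow> ereal" and \<alpha> :: "'i \<Rightarrow> real"
  assumes u: "\<And>i. u i \<noteq> \<infinity>" "\<exists>i. u i \<noteq> -\<infinity>"
    and diag: "\<And>i. s i i = 0"
    and plus: "\<And>i j. max (s i j) 0 = ereal \<bar>\<alpha> i - \<alpha> j\<bar>"
  defines "T \<equiv> \<lambda>i j. s i j + u i + u j"
  shows "(\<exists>i j k l. {i, j} \<noteq> {k, l} \<and> T i j = T k l \<and> (\<forall>m n. T m n \<le> T i j)) \<longleftrightarrow>
    attained_twice (\<lambda>i. ereal (\<alpha> i) + u i) UNIV \<or>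
    attained_twice (\<lambda>i. ereal (- \<alpha> i) + u i) UNIV"
proof -
  \<comment> \<open>The maximum of a form is a real number, because no \<open>u i\<close> is
    \<infinity> and some \<open>u i\<close> is finite.\<close>
  have max_real: "\<exists>i m. ereal (\<beta> i) + u i = ereal m \<and> (\<forall>k. ereal (\<beta> k) + u k \<le> ereal m)"
    for \<beta> :: "'i \<Rightarrow> real"
  proof -
    let ?F = "\<lambda>i. ereal (\<beta> i) + u i"
    have "Max (range ?F) \<in> range ?F"
      by (rule Max_in) auto
    then obtain i where i: "Max (range ?F) = ?F i"
      by (rule imageE)
    have le: "?F k \<le> ?F i" for k
      unfolding i[symmetric] by (rule Max_ge) auto
    obtain k where "u k \<noteq> -\<infinity>"
      using u(2) by blast
    then have "?F i \<noteq> -\<infinity>" "?F i \<noteq> \<infinity>"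
      using le[of k] u(1)[of i] u(1)[of k] by (cases "u i"; cases "u k"; simp)+
    then obtain m where "?F i = ereal m"
      by (cases "?F i") auto
    with le show ?thesis
      by metis
  qed
  \<comment> \<open>In the product of the two forms, the monomial of \<open>i\<close> and
    \<open>j\<close> has the larger of \<open>\<alpha> i - \<alpha> j\<close> and
    \<open>\<alpha> j - \<alpha> i\<close> as coefficient, that is
    \<open>\<bar>\<alpha> i - \<alpha> j\<bar>\<close>. The value of the product is
    \<open>m1 + m2\<close>.\<close>
  define F where "F i = ereal (\<alpha> i) + u i" for i
  define G where "G i = ereal (- \<alpha> i) + u i" for i
  obtain i0 m1 where F0: "F i0 = ereal m1" and F_le: "\<And>k. F k \<le> ereal m1"
    using max_real[of \<alpha>] unfolding F_def by blast
  obtain j0 m2 where G0: "G j0 = ereal m2" and G_le: "\<And>k. G k \<le> ereal m2"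
    using max_real[of "\<lambda>i. - \<alpha> i"] unfolding G_def by blast
  have F_twice: "attained_twice F UNIV \<longleftrightarrow> (\<exists>i j. i \<noteq> j \<and> F i = ereal m1 \<and> F j = ereal m1)"
    using F0 F_le by (auto simp: attained_twice_iff) (metis antisym)+
  have G_twice: "attained_twice G UNIV \<longleftrightarrow> (\<exists>i j. i \<noteq> j \<and> G i = ereal m2 \<and> G j = ereal m2)"
    using G0 G_le by (auto simp: attained_twice_iff) (metis antisym)+
  have s_le: "s i j \<le> ereal \<bar>\<alpha> i - \<alpha> j\<bar>" for i j
    using plus[of i j] by (metis max.cobounded1)
  \<comment> \<open>For finite coordinates, \<open>T i j\<close> is at most the larger of
    \<open>F i + G j\<close> and \<open>F j + G i\<close>.\<close>
  have T_le: "T i j \<le> ereal (m1 + m2)" for i j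
  proof (cases "u i = -\<infinity> \<or> u j = -\<infinity>")
    case True
    then show ?thesis
      using u(1)[of i] u(1)[of j] s_le[of i j] unfolding T_def
      by (cases "s i j"; cases "u i"; cases "u j") auto
  next
    case False
    then show ?thesis
      using u(1)[of i] u(1)[of j] s_le[of i j] F_le[of i] F_le[of j] G_le[of i] G_le[of j]
      unfolding T_def F_def G_def by (cases "s i j"; cases "u i"; cases "u j") auto
  qed
  \<comment> \<open>Two summands bounded by the reals \<open>m1\<close> and \<open>m2\<close> add up
    to \<open>m1 + m2\<close> only if both bounds are attained.\<close>
  have tight: "F i = ereal m1 \<and> G j = ereal m2 \<or> F j = ereal m1 \<and> G i = ereal m2"
    if "T i j = ereal (m1 + m2)" for i j
    using that u(1)[of i] u(1)[of j] s_le[of i j] F_le[of i] F_le[of j] G_le[of i] G_le[of j]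
    unfolding T_def F_def G_def by (cases "s i j"; cases "u i"; cases "u j") auto
  \<comment> \<open>If \<open>s i j < 0\<close>, the mixed monomial is dominated by the two squares.\<close>
  have attain: "T i j = ereal (m1 + m2) \<or>
      i \<noteq> j \<and> T i i = ereal (m1 + m2) \<and> T j j = ereal (m1 + m2)"
    if FG: "F i = ereal m1" "G j = ereal m2" for i j
  proof -
    obtain x y where xy: "u i = ereal x" "u j = ereal y"
      using FG u(1)[of i] u(1)[of j] unfolding F_def G_def by (cases "u i"; cases "u j") auto
    have sum: "x + y + (\<alpha> i - \<alpha> j) = m1 + m2"
      using FG by (auto simp: F_def G_def xy)
    show ?thesis
    proof (cases "s i j \<ge> 0")
      case True
      then have "s i j = ereal \<bar>\<alpha> i - \<alpha> j\<bar>"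
        using plus[of i j] by (simp add: max_def split: if_splits)
      then show ?thesis
        using T_le[of i j] sum by (simp add: T_def xy)
    next
      case False
      then have "\<alpha> i = \<alpha> j"
        using plus[of i j] by (simp add: max_def zero_ereal_def split: if_splits)
      moreover have "i \<noteq> j"
        using False diag by auto
      ultimately show ?thesis
        using T_le[of i i] T_le[of j j] sum by (simp add: T_def xy diag)
    qed
  qed
  \<comment> \<open>By \<open>T_le\<close> and \<open>attain\<close>, the maximum of
    \<open>T\<close> is \<open>m1 + m2\<close>.\<close>
  have "(\<exists>i j k l. {i, j} \<noteq> {k, l} \<and> T i j = T k l \<and> (\<forall>m n. T m n \<le> T i j)) \<longleftrightarrow>
      (\<exists>i j k l. {i, j} \<noteq> {k, l} \<and> T i j = ereal (m1 + m2) \<and> T k l = ereal (m1 + m2))"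
    using T_le attain[OF F0 G0] by (metis antisym)
  also have "\<dots> \<longleftrightarrow> attained_twice F UNIV \<or> attained_twice G UNIV"
  proof
    assume "\<exists>i j k l. {i, j} \<noteq> {k, l} \<and> T i j = ereal (m1 + m2) \<and> T k l = ereal (m1 + m2)"
    then obtain i j k l where ne: "{i, j} \<noteq> {k, l}"
      and max: "T i j = ereal (m1 + m2)" "T k l = ereal (m1 + m2)"
      by blast
    show "attained_twice F UNIV \<or> attained_twice G UNIV"
    proof (rule ccontr)
      \<comment> \<open>With unique maximisers \<open>i0\<close> and \<open>j0\<close>,
        \<open>tight\<close> leaves \<open>{i0, j0}\<close> as the only maximal monomial.\<close>
      assume "\<not> (attained_twice F UNIV \<or> attained_twice G UNIV)"
      then have "F x = ereal m1 \<Longrightarrow> x = i0" "G x = ereal m2 \<Longrightarrow> x = j0" for x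
        unfolding F_twice G_twice using F0 G0 by blast+
      then have "{i, j} = {i0, j0}" "{k, l} = {i0, j0}"
        using tight[OF max(1)] tight[OF max(2)] by blast+
      with ne show False
        by simp
    qed
  next
    \<comment> \<open>The second alternative of \<open>attain\<close> supplies two distinct maximal
      monomials by itself.\<close>
    have squares: "\<exists>i j k l. {i, j} \<noteq> {k, l} \<and> T i j = ereal (m1 + m2) \<and> T k l = ereal (m1 + m2)"
      if "i \<noteq> j \<and> T i i = ereal (m1 + m2) \<and> T j j = ereal (m1 + m2)" for i j
      using that by (intro exI[of _ i] exI[of _ j]) auto
    assume "attained_twice F UNIV \<or> attained_twice G UNIV"
    then consider i j where "i \<noteq> j" "F i = ereal m1" "F j = ereal m1"
      | i j where "i \<noteq> j" "G i = ereal m2" "G j = ereal m2"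
      unfolding F_twice G_twice by blast
    then show "\<exists>i j k l. {i, j} \<noteq> {k, l} \<and> T i j = ereal (m1 + m2) \<and> T k l = ereal (m1 + m2)"
    proof cases
      case 1
      \<comment> \<open>Two maximisers of one form, each combined with a fixed maximiser of the
        other, give different monomials.\<close>
      then have "{i, j0} \<noteq> {j, j0}"
        by (auto simp: doubleton_eq_iff)
      then show ?thesis
        using attain[OF 1(2) G0] attain[OF 1(3) G0] squares by blast
    next
      case 2
      then have "{i0, i} \<noteq> {i0, j}"
        by (auto simp: doubleton_eq_iff)
      then show ?thesis
        using attain[OF F0 2(2)] attain[OF F0 2(3)] squares by blast
    qed
  qed
  finally show ?thesis
    unfolding F_def G_def .
qed

section \<open>The conic in normalised coordinates\<close>

definition diag_coeff :: "quadric \<Rightarrow> 3 \<Rightarrow> real" where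
  "diag_coeff P i = real_of_ereal (coeff_matrix P $ i $ i)"

lemma coeff_matrix_simps:
  "coeff_matrix P $ 1 $ 1 = ereal (a11 P)" "coeff_matrix P $ 2 $ 2 = ereal (a22 P)"
  "coeff_matrix P $ 3 $ 3 = ereal (a33 P)"
  "coeff_matrix P $ 1 $ 2 = a21 P" "coeff_matrix P $ 2 $ 1 = a21 P"
  "coeff_matrix P $ 2 $ 3 = a32 P" "coeff_matrix P $ 3 $ 2 = a32 P"
  "coeff_matrix P $ 1 $ 3 = a31 P" "coeff_matrix P $ 3 $ 1 = a31 P"
  by (simp_all add: coeff_matrix_def)

lemma coeff_matrix_diag: "coeff_matrix P $ i $ i = ereal (diag_coeff P i)"
  using exhaust_3[of i] by (auto simp: diag_coeff_def coeff_matrix_simps)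

lemma coeff_matrix_sym: "coeff_matrix P $ i $ j = coeff_matrix P $ j $ i"
  using exhaust_3[of i] exhaust_3[of j] by (auto simp: coeff_matrix_simps)

lemma coeff_matrix_not_PInf: "is_trop_quadric P \<Longrightarrow> coeff_matrix P $ i $ j \<noteq> \<infinity>"
  using exhaust_3[of i] exhaust_3[of j] by (auto simp: is_trop_quadric_def coeff_matrix_simps)

lemma shape_diag: "shape P $ i $ i = 0"
  by (simp add: shape_def)

lemma shape_sym: "shape P $ i $ j = shape P $ j $ i"
  by (simp add: shape_def coeff_matrix_sym[of P i j] add.commute)

lemma shape_not_PInf:
  assumes "is_trop_quadric P"
  shows "shape P $ i $ j \<noteq> \<infinity>"
  using coeff_matrix_not_PInf[OF assms, of i j]
  by (cases "coeff_matrix P $ i $ j") (auto simp: shape_def coeff_matrix_diag)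

text \<open>Translating each coordinate by half of its diagonal coefficient makes the coefficients
  of the squares 0 and turns the others into the shape entries.\<close>

lemma coeff_matrix_eq_shape:
  "coeff_matrix P $ i $ j + x + y =
    shape P $ i $ j + (ereal (diag_coeff P i / 2) + x) + (ereal (diag_coeff P j / 2) + y)"
proof (cases "i = j")
  case True
  then show ?thesis
    by (cases x; cases y) (simp_all add: shape_diag coeff_matrix_diag)
next
  case False
  then show ?thesis
    by (cases x; cases y; cases "coeff_matrix P $ i $ j")
      (simp_all add: shape_def coeff_matrix_diag add_divide_distrib)
qed

text \<open>Replacing the list of six terms by a function symmetric in its indices lets later
  arguments name the three coordinates in any order. The pairs \<open>e k\<close> follow the order
  of the list and meet each unordered pair once.\<close>

lemma attained_twice_quadric_iff:
  fixes P :: quadric and b :: "ereal^3"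
  defines "T \<equiv> \<lambda>i j. coeff_matrix P $ i $ j + b $ i + b $ j"
  shows "attained_twice (\<lambda>k. quadric_terms P b ! k) {..<6} \<longleftrightarrow>
    (\<exists>i j k l. {i, j} \<noteq> {k, l} \<and> T i j = T k l \<and> (\<forall>m n. T m n \<le> T i j))"
proof -
  define e :: "nat \<Rightarrow> 3 \<times> 3" where "e k = [(1,1), (2,2), (3,3), (1,2), (2,3), (1,3)] ! k" for k
  have less6: "k < 6 \<longleftrightarrow> k \<in> {0, 1, 2, 3, 4, 5}" for k :: nat
    by auto
  have sym: "T i j = T j i" for i j
    by (simp add: T_def coeff_matrix_sym[of P i j] ac_simps)
  have double: "ereal 2 * x = x + x" for x
    by (cases x) auto
  have term_eq: "quadric_terms P b ! k = case_prod T (e k)" if "k < 6" for k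
    using that unfolding less6
    by (auto simp: quadric_terms_def e_def T_def coeff_matrix_simps double add.assoc)
  have inj: "{fst (e k), snd (e k)} \<noteq> {fst (e l), snd (e l)}"
    if "k < 6" "l < 6" "k \<noteq> l" for k l
    using that unfolding less6 by (auto simp: e_def doubleton_eq_iff)
  have surj: "\<exists>k<6. e k = (i, j) \<or> e k = (j, i)" for i j
  proof -
    have "\<exists>k\<in>{0, 1, 2, 3, 4, 5}. e k = (i, j) \<or> e k = (j, i)"
      using exhaust_3[of i] exhaust_3[of j] by (elim disjE) (simp_all add: e_def)
    then show ?thesis
      by (simp only: less6 Bex_def)
  qed
  have twice: "attained_twice (\<lambda>k. quadric_terms P b ! k) {..<6} \<longleftrightarrow>
      (\<exists>k<6. \<exists>l<6. k \<noteq> l \<and> case_prod T (e k) = case_prod T (e l) \<and>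
        (\<forall>m<6. case_prod T (e m) \<le> case_prod T (e k)))"
    by (simp add: attained_twice_iff term_eq Bex_def Ball_def cong: conj_cong)
  show ?thesis
  proof
    assume "attained_twice (\<lambda>k. quadric_terms P b ! k) {..<6}"
    then obtain k l where kl: "k < 6" "l < 6" "k \<noteq> l"
        "case_prod T (e k) = case_prod T (e l)"
        "\<And>m. m < 6 \<Longrightarrow> case_prod T (e m) \<le> case_prod T (e k)"
      unfolding twice by blast
    have "T m n \<le> case_prod T (e k)" for m n
      using surj[of m n] kl(5) sym by (metis case_prod_conv)
    then show "\<exists>i j k l. {i, j} \<noteq> {k, l} \<and> T i j = T k l \<and> (\<forall>m n. T m n \<le> T i j)"
      using inj[OF kl(1-3)] kl(4) by (metis case_prod_unfold)
  next
    assume "\<exists>i j k l. {i, j} \<noteq> {k, l} \<and> T i j = T k l \<and> (\<forall>m n. T m n \<le> T i j)"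
    then obtain i j k l where ne: "{i, j} \<noteq> {k, l}" and eq: "T i j = T k l"
      and max: "\<And>m n. T m n \<le> T i j"
      by blast
    obtain x where x: "x < 6" "e x = (i, j) \<or> e x = (j, i)"
      using surj by blast
    obtain y where y: "y < 6" "e y = (k, l) \<or> e y = (l, k)"
      using surj by blast
    have "x \<noteq> y"
      using ne x(2) y(2) by (auto simp: insert_commute)
    moreover have "case_prod T (e x) = T i j" "case_prod T (e y) = T i j"
      using x(2) y(2) eq sym by auto
    moreover have "case_prod T (e m) \<le> T i j" for m
      using max by (simp add: case_prod_unfold)
    ultimately have "x \<noteq> y \<and> case_prod T (e x) = case_prod T (e y) \<and>
        (\<forall>m<6. case_prod T (e m) \<le> case_prod T (e x))"
      by simp
    with x(1) y(1) show "attained_twice (\<lambda>k. quadric_terms P b ! k) {..<6}"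
      unfolding twice by blast
  qed
qed

lemma attained_twice_quadric_shape_iff:
  fixes P :: quadric and b :: "ereal^3"
  defines "u \<equiv> \<lambda>i. ereal (diag_coeff P i / 2) + b $ i"
  defines "T \<equiv> \<lambda>i j. shape P $ i $ j + u i + u j"
  shows "attained_twice (\<lambda>k. quadric_terms P b ! k) {..<6} \<longleftrightarrow>
    (\<exists>i j k l. {i, j} \<noteq> {k, l} \<and> T i j = T k l \<and> (\<forall>m n. T m n \<le> T i j))"
  unfolding attained_twice_quadric_iff coeff_matrix_eq_shape T_def u_def ..

section \<open>Conics that are pairs of lines\<close>

lemma pair_of_linesI:
  assumes plus: "\<And>i j. matrix_plus (shape P) $ i $ j = ereal \<bar>\<alpha> i - \<alpha> j\<bar>"
  shows "pair_of_lines (trop_conic P)"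
proof -
  \<comment> \<open>The half diagonal coefficients carry the forms \<alpha> and -\<alpha> back from
    normalised coordinates.\<close>
  define c c' :: "real^3"
    where "c = (\<chi> i. \<alpha> i + diag_coeff P i / 2)" and "c' = (\<chi> i. - \<alpha> i + diag_coeff P i / 2)"
  have "attained_twice (\<lambda>k. quadric_terms P b ! k) {..<6} \<longleftrightarrow>
      attained_twice (\<lambda>i. ereal (c $ i) + b $ i) UNIV \<or>
      attained_twice (\<lambda>i. ereal (c' $ i) + b $ i) UNIV" if b: "b \<in> trop_triples" for b
  proof -
    define u where "u i = ereal (diag_coeff P i / 2) + b $ i" for i
    have "u i \<noteq> \<infinity>" for i
      using b by (auto simp: u_def trop_triples_def)
    moreover have "\<exists>i. u i \<noteq> -\<infinity>"
      using b by (auto simp: u_def trop_triples_def)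
    moreover have "max (shape P $ i $ j) 0 = ereal \<bar>\<alpha> i - \<alpha> j\<bar>" for i j
      using plus[of i j] by (simp add: matrix_plus_def)
    ultimately have "attained_twice (\<lambda>k. quadric_terms P b ! k) {..<6} \<longleftrightarrow>
        attained_twice (\<lambda>i. ereal (\<alpha> i) + u i) UNIV \<or>
        attained_twice (\<lambda>i. ereal (- \<alpha> i) + u i) UNIV"
      unfolding attained_twice_quadric_shape_iff u_def[symmetric]
      by (intro attained_twice_product) (auto simp: shape_diag)
    moreover have "ereal (\<alpha> i) + u i = ereal (c $ i) + b $ i"
        "ereal (- \<alpha> i) + u i = ereal (c' $ i) + b $ i" for i
      by (cases "b $ i"; simp add: u_def c_def c'_def)+
    ultimately show ?thesis
      by simp
  qed
  \<comment> \<open>Every representative of a point is thus covered by the equivalence for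
    triples.\<close>
  moreover have "p \<subseteq> trop_triples" if "p \<in> TP2" for p
    using that equiv_proj_rel by (auto simp: TP2_def elim!: quotientE simp: proj_rel_def)
  ultimately have "trop_conic P = trop_line c \<union> trop_line c'"
    unfolding trop_conic_def trop_line_def by blast
  then show ?thesis
    unfolding pair_of_lines_def by blast
qed

section \<open>Conics that are not pairs of lines\<close>

lemma proj_class_in_TP2:
  assumes "b \<in> trop_triples"
  shows "proj_rel `` {b} \<in> TP2" "b \<in> proj_rel `` {b}"
  using assms equiv_class_self[OF equiv_proj_rel] by (auto simp: TP2_def quotientI)

lemma proj_class_in_trop_conic:
  assumes "b \<in> trop_triples" "attained_twice (\<lambda>k. quadric_terms P b ! k) {..<6}"
  shows "proj_rel `` {b} \<in> trop_conic P"
  using assms proj_class_in_TP2 unfolding trop_conic_def by blast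

lemma proj_class_in_trop_lineD:
  assumes "proj_rel `` {b} \<in> trop_line c"
  shows "attained_twice (\<lambda>i. ereal (c $ i) + b $ i) UNIV"
  using assms trop_line_rep_independent unfolding trop_line_def by blast

text \<open>Along \<open>b t\<close> the three terms of a linear form are affine in \<open>t\<close>
  with slopes 0, 1 and -1, so any two of them agree for exactly one \<open>t\<close>. Relative to
  the base point \<open>a\<close>, the points satisfy
  \<open>2 * X i = x + X j + X k\<close>.\<close>

lemma finite_line_inter_segment:
  fixes i j k :: 3 and a c :: "real^3" and x :: real
  assumes ijk: "i \<noteq> j" "i \<noteq> k" "j \<noteq> k"
  defines "b \<equiv> \<lambda>t. \<chi> m. a $ m + (if m = i then 0 else if m = j then t else - x - t)"
  shows "finite {t. attained_twice (\<lambda>m. ereal (c $ m) + ereal (b t $ m)) UNIV}"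
proof (rule finite_subset)
  let ?d = "c + a"
  show "{t. attained_twice (\<lambda>m. ereal (c $ m) + ereal (b t $ m)) UNIV} \<subseteq>
    {?d $ i - ?d $ j, ?d $ k - ?d $ i - x, (?d $ k - ?d $ j - x) / 2}"
  proof
    fix t
    assume "t \<in> {t. attained_twice (\<lambda>m. ereal (c $ m) + ereal (b t $ m)) UNIV}"
    then obtain m n where "m \<noteq> n" "c $ m + b t $ m = c $ n + b t $ n"
      by (auto simp: attained_twice_iff)
    have "m = i \<or> m = j \<or> m = k" for m
      using ijk exhaust_3_distinct by blast
    from this[of m] this[of n] \<open>m \<noteq> n\<close> \<open>c $ m + b t $ m = c $ n + b t $ n\<close>
    show "t \<in> {?d $ i - ?d $ j, ?d $ k - ?d $ i - x, (?d $ k - ?d $ j - x) / 2}"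
      using ijk by (auto simp: b_def field_simps)
  qed
qed simp

lemma not_pair_of_lines:
  fixes w :: "3 \<Rightarrow> 3 \<Rightarrow> real"
  assumes w: "\<And>m n. matrix_plus (shape P) $ m $ n = ereal (w m n)"
    and ijk: "i \<noteq> j" "i \<noteq> k" "j \<noteq> k"
    and gap: "w j k > w j i + w i k"
  shows "\<not> pair_of_lines (trop_conic P)"
proof
  assume "pair_of_lines (trop_conic P)"
  then obtain c c' where C: "trop_conic P = trop_line c \<union> trop_line c'"
    unfolding pair_of_lines_def by blast
  have UN: "m = i \<or> m = j \<or> m = k" for m
    using ijk exhaust_3_distinct by blast
  have plus: "max (shape P $ m $ n) 0 = ereal (w m n)" for m n
    using w[of m n] by (simp add: matrix_plus_def)
  have nonneg: "0 \<le> w m n" for m n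
    using plus[of m n] by (metis ereal_less_eq(5) max.cobounded2)
  have sym: "w m n = w n m" for m n
    using plus[of m n] plus[of n m] by (simp add: shape_sym[of P m n])
  have diag: "w m m = 0" for m
    using plus[of m m] by (simp add: shape_diag zero_ereal_def)
  have shape_le: "shape P $ m $ n \<le> ereal (w m n)" for m n
    using plus[of m n] by (metis max.cobounded1)
  \<comment> \<open>The gap makes \<open>w j k\<close> positive, so truncation at 0 has not changed
    this entry.\<close>
  have shape_jk: "shape P $ j $ k = ereal (w j k)"
    using plus[of j k] gap nonneg[of j i] nonneg[of i k]
    by (auto simp: max_def zero_ereal_def split: if_splits)
  \<comment> \<open>The vector \<open>a\<close> cancels the normalising translation:
    \<open>v t\<close> holds the normalised coordinates of \<open>b t\<close>.\<close>
  define a :: "real^3" where "a = (\<chi> m. - diag_coeff P m / 2)"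
  define v where "v t m = (if m = i then 0 else if m = j then t else - w j k - t)" for t m
  define b where "b t = (\<chi> m. a $ m + v t m)" for t
  \<comment> \<open>The terms of \<open>{i, i}\<close> and \<open>{j, k}\<close> are 0 for every
    \<open>t\<close>. The endpoints are where the bounds \<open>w i j + t\<close> and
    \<open>w i k - w j k - t\<close> on the other mixed terms reach 0; between them no term is
    positive.\<close>
  have "{w i k - w j k..- w j i} \<subseteq>
      {t. attained_twice (\<lambda>m. ereal (c $ m) + ereal (b t $ m)) UNIV} \<union>
      {t. attained_twice (\<lambda>m. ereal (c' $ m) + ereal (b t $ m)) UNIV}"
  proof
    fix t
    assume t: "t \<in> {w i k - w j k..- w j i}"
    define B :: "ereal^3" where "B = (\<chi> m. ereal (b t $ m))"
    have B: "B \<in> trop_triples"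
      by (auto simp: B_def trop_triples_def)
    have u: "ereal (diag_coeff P m / 2) + B $ m = ereal (v t m)" for m
      by (simp add: B_def b_def a_def)
    let ?T = "\<lambda>m n. shape P $ m $ n + ereal (v t m) + ereal (v t n)"
    have le: "w m n + v t m + v t n \<le> 0" for m n
      using UN[of m] UN[of n] t ijk nonneg[of j i] nonneg[of i k] sym[of i j] sym[of k i] sym[of k j]
      by (auto simp: v_def diag)
    have "?T m n \<le> 0" for m n
      using shape_le[of m n] le[of m n] by (cases "shape P $ m $ n") auto
    moreover have "?T i i = 0" "?T j k = 0"
      using ijk by (auto simp: v_def shape_diag shape_jk)
    moreover have "{i, i} \<noteq> {j, k}"
      using ijk by auto
    ultimately have "attained_twice (\<lambda>k. quadric_terms P B ! k) {..<6}"
      unfolding attained_twice_quadric_shape_iff u by metis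
    then have "proj_rel `` {B} \<in> trop_line c \<union> trop_line c'"
      using proj_class_in_trop_conic B C by blast
    then show "t \<in> {t. attained_twice (\<lambda>m. ereal (c $ m) + ereal (b t $ m)) UNIV} \<union>
        {t. attained_twice (\<lambda>m. ereal (c' $ m) + ereal (b t $ m)) UNIV}"
      using proj_class_in_trop_lineD unfolding B_def by fastforce
  qed
  then have "finite {w i k - w j k..- w j i}"
    by (rule finite_subset)
      (auto simp only: b_def v_def finite_Un intro!: finite_line_inter_segment[OF ijk])
  \<comment> \<open>The gap says exactly that this interval has positive length.\<close>
  moreover have "infinite {w i k - w j k..- w j i}"
    using gap by (intro infinite_Icc) simp
  ultimately show False
    by blast
qed

section \<open>Strict, degenerate and violated triangle inequalities\<close>

theorem corollary4:
  fixes P :: quadric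
  assumes "is_trop_quadric P"
  shows "trop_singular (matrix_plus (shape P)) \<longleftrightarrow>
         pair_of_lines (trop_conic P) \<or> one_point_central P"
proof -
  define w where "w i j = real_of_ereal (matrix_plus (shape P) $ i $ j)" for i j
  have w: "matrix_plus (shape P) $ i $ j = ereal (w i j)" for i j
    using shape_not_PInf[OF assms, of i j]
    by (cases "shape P $ i $ j") (auto simp: w_def matrix_plus_def max_def)
  have sym: "w i j = w j i" for i j
    by (simp add: w_def matrix_plus_def shape_sym[of P i j])
  have diag: "w i i = 0" for i
    by (simp add: w_def matrix_plus_def shape_diag)
  have nonneg: "w i j \<ge> 0" for i j
    by (simp add: w_def matrix_plus_def real_of_ereal_pos)
  \<comment> \<open>The numbers \<open>d1\<close>, \<open>d2\<close>, \<open>d3\<close> are the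
    slacks of the triangle inequalities. Two of them sum to twice an off-diagonal entry, which gives
    its sign.\<close>
  have central: "one_point_central P \<longleftrightarrow>
      w 1 2 < w 1 3 + w 2 3 \<and> w 1 3 < w 1 2 + w 2 3 \<and> w 2 3 < w 1 2 + w 1 3"
    by (auto simp: one_point_central_def Let_def w forall_3 sym[of 2 1] sym[of 3 1] sym[of 3 2])
  have singular: "trop_singular (matrix_plus (shape P)) \<longleftrightarrow> (\<forall>i j k. w i k \<le> w i j + w j k)"
    using trop_singular_iff_triangle[OF w sym diag nonneg] .
  show ?thesis
  proof (cases "\<forall>i j k. w i k \<le> w i j + w j k")
    case True
    have degenerate: "pair_of_lines (trop_conic P)" if eq: "w i k = w i j + w j k"
      and ijk: "i \<noteq> j" "i \<noteq> k" "j \<noteq> k" for i j k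
    proof (rule pair_of_linesI)
      \<comment> \<open>On the real line, \<open>j\<close> sits at the origin with \<open>i\<close>
        and \<open>k\<close> on opposite sides; by \<open>eq\<close> the distance of
        \<open>i\<close> and \<open>k\<close> is then \<open>w i k\<close>.\<close>
      define \<alpha> where "\<alpha> m = (if m = j then 0 else if m = i then w i j else - w j k)" for m
      have UN: "m = i \<or> m = j \<or> m = k" for m
        using ijk exhaust_3_distinct by blast
      show "matrix_plus (shape P) $ m $ n = ereal \<bar>\<alpha> m - \<alpha> n\<bar>" for m n
        using UN[of m] UN[of n] eq ijk nonneg[of i j] nonneg[of j k]
          sym[of j i] sym[of k i] sym[of k j]
        by (auto simp: w \<alpha>_def diag)
    qed
    have "pair_of_lines (trop_conic P)"
      if "w 1 2 = w 1 3 + w 2 3 \<or> w 1 3 = w 1 2 + w 2 3 \<or> w 2 3 = w 1 2 + w 1 3"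
    proof -
      have "(1 :: 3) \<noteq> 2" "(1 :: 3) \<noteq> 3" "(2 :: 3) \<noteq> 3"
        by simp_all
      then show ?thesis
        using that degenerate[of 1 2 3] degenerate[of 1 3 2] degenerate[of 2 3 1] sym by metis
    qed
    moreover have "w 1 2 \<le> w 1 3 + w 2 3" "w 1 3 \<le> w 1 2 + w 2 3" "w 2 3 \<le> w 1 2 + w 1 3"
      using True sym by metis+
    ultimately have "pair_of_lines (trop_conic P) \<or> one_point_central P"
      unfolding central less_le by blast
    with True show ?thesis
      unfolding singular by blast
  next
    case False
    then obtain i j k where gap: "w i k > w i j + w j k"
      by (auto simp: not_le)
    \<comment> \<open>The intermediate index \<open>j\<close> comes first, as it takes the role of
      \<open>i\<close> in \<open>not_pair_of_lines\<close>.\<close>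
    have ijk: "j \<noteq> i" "j \<noteq> k" "i \<noteq> k"
      using gap diag nonneg[of i j] nonneg[of j k] by auto
    have "\<not> pair_of_lines (trop_conic P)"
      using not_pair_of_lines[OF w ijk gap] .
    moreover have "\<not> one_point_central P"
      unfolding central using gap ijk exhaust_3[of i] exhaust_3[of j] exhaust_3[of k]
      by (auto simp: sym[of 2 1] sym[of 3 1] sym[of 3 2])
    ultimately show ?thesis
      using False unfolding singular by blast
  qed
qed

end
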